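(* Let $\mathbb{H}=(\mathcal X,P,\{\mathcal Q_n\}_{n\in\mathbb N})$ consist of a finite set $\mathcal X$, a distribution $P\in\mathcal P(\mathcal X)$ and sets $\mathcal Q_n\subseteq\mathcal P(\mathcal X^n)$, and write $\mathcal Q=\mathcal Q_1$. Suppose that Axioms 2, 3, 4 and 5 (stated in the context) are satisfied on some open interval $J=(a,b)$ with $0\le a<1<b\le\infty$. Then $$R_{\rm th}(\mathbb H)=R_{\rm th}^*(\mathbb H)=D(P\|\mathcal Q).$$
   Context: $\mathcal P(\mathcal X)$ is the set of probability mass functions (distributions) on the finite set $\mathcal X$; $P^{\times n}(x^n)=\prod_{i=1}^nP(x_i)$. $\log$ and $\exp$ are inverse to each other, in any fixed base. Hypothesis testing. For a test $T:\mathcal X^n\to[0,1]$ put $\alpha(T;P^{\times n})=\sum_{x^n}P^{\times n}(x^n)(1-T(x^n))$ and $\beta(T;\mathcal Q_n)=\sup_{Q\in\mathcal Q_n}\sum_{x^n}Q(x^n)T(x^n)$. Let $\hat\alpha(\mu;P^{\times n}\|\mathcal Q_n)=\min_T\{\alpha(T;P^{\times n}):\beta(T;\mathcal Q_n)\le\mu\}$. Threshold rates: $R_{\rm th}(\mathbb H)=\sup\{R\in\mathbb R:\limsup_{n\to\infty}\hat\alpha(\exp(-nR);P^{\times n}\|\mathcal Q_n)=0\}$ and $R_{\rm th}^*(\mathbb H)=\inf\{R\in\mathbb R:\liminf_{n\to\infty}\hat\alpha(\exp(-nR);P^{\times n}\|\mathcal Q_n)=1\}$. Rényi divergence. For $s\in(0,1)\cup(1,\infty)$,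 $g_s(P\|Q)=\sum_{x:P(x)>0}P(x)^sQ(x)^{1-s}$ (equal to $+\infty$ if $s>1$ and $Q(x)=0<P(x)$ for some $x$), $D_s(P\|Q)=\frac{1}{s-1}\log g_s(P\|Q)$, and $D_1(P\|Q)=D(P\|Q)=\sum_xP(x)(\log P(x)-\log Q(x))$. For a set, $D_s(P\|\mathcal Q)=\inf_{Q\in\mathcal Q}D_s(P\|Q)$ and $D(P\|\mathcal Q)=D_1(P\|\mathcal Q)$. Permutations. $S_n$ acts on $\mathcal P(\mathcal X^n)$ by $(P^nW^n[\pi])(x_1,\dots,x_n)=P^n(x_{\pi(1)},\dots,x_{\pi(n)})$; $\mathcal P^{\rm sym}(\mathcal X^n)$ is the set of invariant distributions and $\mathcal Q_n^{\rm sym}=\mathcal Q_n\cap\mathcal P^{\rm sym}(\mathcal X^n)$. Axioms on an interval $J$ containing $1$: Axiom 2: $Q^{\times n}\in\mathcal Q_n$ for every $Q\in\mathcal Q$ and $n\in\mathbb N$. Axiom 3: $D_s(P^{\times n}\|\mathcal Q_n)\ge nD_s(P\|\mathcal Q)$ for all $s\in J$, $n\in\mathbb N$. Axiom 4: there are $U^n\in\mathcal P^{\rm sym}(\mathcal X^n)$, $n\in\mathbb N$, and a polynomial $v(n)$ such that for all $n$: $Q(x^n)\le v(n)U^n(x^n)$ for all $Q\in\mathcal Q_n^{\rm sym}$ and $x^n\in\mathcal X^n$; and $D_s(P^{\times n}\|U^n)\ge D_s(P^{\times n}\|\mathcal Q_n)$ for all $s\in J$. Moreover, $P^n\in\mathcal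 Q_n$ implies $\frac1{n!}\sum_{\pi\in S_n}P^nW^n[\pi]\in\mathcal Q_n^{\rm sym}$. Axiom 5: there is a compact convex set $\Theta$ in a finite-dimensional vector space and a $C^2$ map $\theta\mapsto Q_\theta$ with $\mathcal Q=\{Q_\theta:\theta\in\Theta\}$ such that: for all $s\in J$ the minimizer $\hat\theta^s=\arg\min_{\theta\in\Theta}D_s(P\|Q_\theta)$ is unique and lies in the relative interior of $\Theta$; the map $\theta\mapsto g_s(P\|Q_\theta)$ has negative definite Hessian at $\hat\theta^s$ for all $s\in J$ with $s<1$ and positive definite Hessian at $\hat\theta^s$ for all $s\in J$ with $s>1$; and $\theta\mapsto D_1(P\|Q_\theta)$ has positive definite Hessian at $\hat\theta^1$. *)

theory Defs
  imports "HOL-Probability.Probability" "HOL-Computational_Algebra.Polynomial"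
    "HOL-Combinatorics.Permutations"
begin

text \<open>
  The alphabet is a finite type; a point of its n-th power is a list of length n. Lists have
  indices from 0, so the symmetric group acts as the permutations of \<open>{..<n}\<close>.
  The n-fold product distribution is \<^const>\<open>replicate_pmf\<close>.
\<close>

definition words :: "nat \<Rightarrow> 'a list set" where
  "words n = {xs. length xs = n}"

definition dists :: "nat \<Rightarrow> 'a list pmf set" where
  "dists n = {p. set_pmf p \<subseteq> words n}"

definition single_letter :: "(nat \<Rightarrow> 'a list pmf set) \<Rightarrow> 'a pmf set" where
  "single_letter Qs = {Q. map_pmf (\<lambda>x. [x]) Q \<in> Qs 1}"

lemma pmf_replicate_pmf_words:
  fixes P :: "'a pmf"
  shows "xs \<in> words n \<Longrightarrow> pmf (replicate_pmf n P) xs = (\<Prod>i<n. pmf P (xs ! i))"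
proof (induction n arbitrary: xs)
  case 0
  then show ?case by (simp add: words_def)
next
  case (Suc n)
  then obtain y ys where xs: "xs = y # ys" and ys: "ys \<in> words n"
    by (auto simp: words_def length_Suc_conv)
  have "replicate_pmf (Suc n) P = map_pmf (\<lambda>(x, zs). x # zs) (pair_pmf P (replicate_pmf n P))"
    by (simp add: pair_pmf_def map_pmf_def bind_assoc_pmf bind_return_pmf)
  moreover have "inj (\<lambda>(x :: 'a, zs). x # zs)"
    by (auto simp: inj_on_def)
  ultimately have "pmf (replicate_pmf (Suc n) P) xs = pmf P y * pmf (replicate_pmf n P) ys"
    using pmf_map_inj'[of "\<lambda>(x, zs). x # zs" "pair_pmf P (replicate_pmf n P)" "(y, ys)"]
    by (simp add: xs pmf_pair)
  also have "\<dots> = pmf P (xs ! 0) * (\<Prod>i<n. pmf P (xs ! Suc i))"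
    using Suc.IH[OF ys] by (simp add: xs)
  finally show ?case
    by (simp only: prod.lessThan_Suc_shift)
qed

text \<open>
  The mass of \<open>xs\<close> under the permuted distribution is the original mass of
  \<open>permute_list \<pi> xs\<close>, as shown by \<open>pmf_permute_pmf\<close>; since \<^const>\<open>map_pmf\<close> takes preimages,
  the inverse permutation appears in the definition.
\<close>

definition permute_pmf :: "(nat \<Rightarrow> nat) \<Rightarrow> 'a list pmf \<Rightarrow> 'a list pmf" where
  "permute_pmf \<pi> p = map_pmf (permute_list (inv \<pi>)) p"

definition sym_dists :: "nat \<Rightarrow> 'a list pmf set" where
  "sym_dists n = {p \<in> dists n. \<forall>\<pi>. \<pi> permutes {..<n} \<longrightarrow> permute_pmf \<pi> p = p}"

definition symmetrize :: "nat \<Rightarrow> 'a list pmf \<Rightarrow> 'a list pmf" where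
  "symmetrize n p = bind_pmf (pmf_of_set {\<pi>. \<pi> permutes {..<n}}) (\<lambda>\<pi>. permute_pmf \<pi> p)"

lemma pmf_permute_pmf:
  fixes p :: "'a list pmf"
  assumes "p \<in> dists n" "\<pi> permutes {..<n}" "xs \<in> words n"
  shows "pmf (permute_pmf \<pi> p) xs = pmf p (permute_list \<pi> xs)"
proof -
  have \<pi>': "inv \<pi> permutes {..<n}"
    using assms(2) by (rule permutes_inv)
  have len: "length xs = n"
    using assms(3) by (simp add: words_def)
  have inj: "inj_on (permute_list (inv \<pi>)) (words n :: 'a list set)"
  proof (rule inj_on_inverseI)
    fix ys :: "'a list"
    assume "ys \<in> words n"
    then have "permute_list (inv \<pi> \<circ> \<pi>) ys = permute_list \<pi> (permute_list (inv \<pi>) ys)"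
      using assms(2) by (intro permute_list_compose) (simp add: words_def)
    then show "permute_list \<pi> (permute_list (inv \<pi>) ys) = ys"
      using permutes_inv_o(2)[OF assms(2)] by simp
  qed
  have "permute_list (\<pi> \<circ> inv \<pi>) xs = permute_list (inv \<pi>) (permute_list \<pi> xs)"
    using \<pi>' len by (intro permute_list_compose) simp
  then have xs: "xs = permute_list (inv \<pi>) (permute_list \<pi> xs)"
    using permutes_inv_o(1)[OF assms(2)] by simp
  have mem: "permute_list \<pi> xs \<in> words n"
    using len by (simp add: words_def)
  have eq: "permute_list (inv \<pi>) -` {xs} \<inter> set_pmf p = {permute_list \<pi> xs} \<inter> set_pmf p"
    using inj xs mem assms(1) unfolding dists_def inj_on_def by auto
  have "pmf (permute_pmf \<pi> p) xs = measure p (permute_list (inv \<pi>) -` {xs} \<inter> set_pmf p)"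
    by (simp add: permute_pmf_def pmf_map measure_Int_set_pmf)
  also have "\<dots> = pmf p (permute_list \<pi> xs)"
    unfolding eq by (simp add: measure_Int_set_pmf pmf.rep_eq)
  finally show ?thesis .
qed

lemma pmf_symmetrize:
  assumes "p \<in> dists n" "xs \<in> words n"
  shows "pmf (symmetrize n p) xs = (\<Sum>\<pi> | \<pi> permutes {..<n}. pmf p (permute_list \<pi> xs)) / fact n"
proof -
  let ?S = "{\<pi>. \<pi> permutes {..<n}}"
  have fin: "finite ?S" and card: "card ?S = fact n"
    by (simp_all add: finite_permutations card_permutations[OF card_lessThan])
  have "id \<in> ?S"
    by (simp add: permutes_id)
  then have ne: "?S \<noteq> {}"
    by blast
  have "pmf (symmetrize n p) xs = (\<Sum>\<pi>\<in>?S. pmf (permute_pmf \<pi> p) xs) / fact n"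
    using fin ne card by (simp add: symmetrize_def pmf_bind integral_pmf_of_set)
  then show ?thesis
    using assms by (simp add: pmf_permute_pmf)
qed

text \<open>
  \<open>B\<close> is the base of the logarithms. All sums run over the support of the first argument,
  which is finite for distributions on a finite type and for members of \<^const>\<open>dists\<close> over a
  finite type. In \<open>renyi_g\<close> with \<open>s < 1\<close>, letters with \<open>pmf Q x = 0\<close> contribute 0 because
  \<open>0 powr (1 - s) = 0\<close>.
\<close>

definition elog :: "real \<Rightarrow> ereal \<Rightarrow> ereal" where
  "elog B x = (if x = \<infinity> then \<infinity> else if x \<le> 0 then - \<infinity> else ereal (log B (real_of_ereal x)))"

definition renyi_g :: "real \<Rightarrow> 'a pmf \<Rightarrow> 'a pmf \<Rightarrow> ereal" where
  "renyi_g s P Q =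
     (if s > 1 \<and> (\<exists>x. pmf P x > 0 \<and> pmf Q x = 0) then \<infinity>
      else ereal (\<Sum>x\<in>set_pmf P. pmf P x powr s * pmf Q x powr (1 - s)))"

definition rel_entropy :: "real \<Rightarrow> 'a pmf \<Rightarrow> 'a pmf \<Rightarrow> ereal" where
  "rel_entropy B P Q =
     (if \<exists>x. pmf P x > 0 \<and> pmf Q x = 0 then \<infinity>
      else ereal (\<Sum>x\<in>set_pmf P. pmf P x * (log B (pmf P x) - log B (pmf Q x))))"

definition renyi_div :: "real \<Rightarrow> real \<Rightarrow> 'a pmf \<Rightarrow> 'a pmf \<Rightarrow> ereal" where
  "renyi_div B s P Q =
     (if s = 1 then rel_entropy B P Q else ereal (1 / (s - 1)) * elog B (renyi_g s P Q))"

definition renyi_div_set :: "real \<Rightarrow> real \<Rightarrow> 'a pmf \<Rightarrow> 'a pmf set \<Rightarrow> ereal" where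
  "renyi_div_set B s P \<Q> = (INF Q\<in>\<Q>. renyi_div B s P Q)"

definition is_test :: "nat \<Rightarrow> ('a list \<Rightarrow> real) \<Rightarrow> bool" where
  "is_test n T \<longleftrightarrow> (\<forall>xs\<in>words n. 0 \<le> T xs \<and> T xs \<le> 1)"

definition type1_error :: "nat \<Rightarrow> ('a list \<Rightarrow> real) \<Rightarrow> 'a list pmf \<Rightarrow> real" where
  "type1_error n T p = (\<Sum>xs\<in>words n. pmf p xs * (1 - T xs))"

definition type2_error :: "nat \<Rightarrow> ('a list \<Rightarrow> real) \<Rightarrow> 'a list pmf set \<Rightarrow> ereal" where
  "type2_error n T \<Q> = (SUP Q\<in>\<Q>. ereal (\<Sum>xs\<in>words n. pmf Q xs * T xs))"

text \<open>
  For \<open>\<mu> \<ge> 0\<close> the feasible tests restricted to words of length n form a nonempty compact set, so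
  this infimum is a minimum.
\<close>

definition min_type1 :: "nat \<Rightarrow> real \<Rightarrow> 'a list pmf \<Rightarrow> 'a list pmf set \<Rightarrow> ereal" where
  "min_type1 n \<mu> p \<Q> =
     (INF T\<in>{T. is_test n T \<and> type2_error n T \<Q> \<le> ereal \<mu>}. ereal (type1_error n T p))"

definition R_th :: "real \<Rightarrow> 'a pmf \<Rightarrow> (nat \<Rightarrow> 'a list pmf set) \<Rightarrow> ereal" where
  "R_th B P Qs =
     (SUP R\<in>{R :: real.
         limsup (\<lambda>n. min_type1 n (B powr (- real n * R)) (replicate_pmf n P) (Qs n)) = 0}. ereal R)"

definition R_th_star :: "real \<Rightarrow> 'a pmf \<Rightarrow> (nat \<Rightarrow> 'a list pmf set) \<Rightarrow> ereal" where
  "R_th_star B P Qs =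
     (INF R\<in>{R :: real.
         liminf (\<lambda>n. min_type1 n (B powr (- real n * R)) (replicate_pmf n P) (Qs n)) = 1}. ereal R)"

text \<open>
  The parameter set may be lower-dimensional. Gradients and second derivatives within the set
  are then determined only along its linear direction space, and definiteness of a Hessian is
  required only there.
\<close>

definition C2_on :: "('v::euclidean_space \<Rightarrow> real) \<Rightarrow> 'v set \<Rightarrow> bool" where
  "C2_on f S \<longleftrightarrow>
     (\<exists>(grad :: 'v \<Rightarrow> 'v) (H :: 'v \<Rightarrow> 'v \<Rightarrow>\<^sub>L 'v).
        (\<forall>x\<in>S. (f has_derivative (\<lambda>h. grad x \<bullet> h)) (at x within S) \<and>
               (grad has_derivative blinfun_apply (H x)) (at x within S)) \<and>
        continuous_on S H)"

definition direction_space :: "'v::euclidean_space set \<Rightarrow> 'v set" where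
  "direction_space S = span {x - y | x y. x \<in> S \<and> y \<in> S}"

text \<open>An extended-valued function has a Hessian at a point only if it is finite around it.\<close>

definition has_hessian :: "('v::euclidean_space \<Rightarrow> ereal) \<Rightarrow> ('v \<Rightarrow> 'v) \<Rightarrow> 'v \<Rightarrow> 'v set \<Rightarrow> bool" where
  "has_hessian F H x S \<longleftrightarrow>
     (\<exists>grad :: 'v \<Rightarrow> 'v.
        (\<forall>\<^sub>F y in inf (nhds x) (principal S).
           \<bar>F y\<bar> \<noteq> \<infinity> \<and>
           ((\<lambda>z. real_of_ereal (F z)) has_derivative (\<lambda>h. grad y \<bullet> h)) (at y within S)) \<and>
        (grad has_derivative H) (at x within S))"

definition pos_def_hessian :: "('v::euclidean_space \<Rightarrow> ereal) \<Rightarrow> 'v \<Rightarrow> 'v set \<Rightarrow> bool" where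
  "pos_def_hessian F x S \<longleftrightarrow>
     (\<exists>H. has_hessian F H x S \<and> (\<forall>v\<in>direction_space S. v \<noteq> 0 \<longrightarrow> v \<bullet> H v > 0))"

definition neg_def_hessian :: "('v::euclidean_space \<Rightarrow> ereal) \<Rightarrow> 'v \<Rightarrow> 'v set \<Rightarrow> bool" where
  "neg_def_hessian F x S \<longleftrightarrow>
     (\<exists>H. has_hessian F H x S \<and> (\<forall>v\<in>direction_space S. v \<noteq> 0 \<longrightarrow> v \<bullet> H v < 0))"

definition axiom2 :: "(nat \<Rightarrow> 'a list pmf set) \<Rightarrow> bool" where
  "axiom2 Qs \<longleftrightarrow> (\<forall>Q\<in>single_letter Qs. \<forall>n\<ge>1. replicate_pmf n Q \<in> Qs n)"

definition axiom3 :: "real \<Rightarrow> real set \<Rightarrow> 'a pmf \<Rightarrow> (nat \<Rightarrow> 'a list pmf set) \<Rightarrow> bool" where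
  "axiom3 B J P Qs \<longleftrightarrow>
     (\<forall>s\<in>J. \<forall>n\<ge>1. renyi_div_set B s (replicate_pmf n P) (Qs n)
                     \<ge> ereal (real n) * renyi_div_set B s P (single_letter Qs))"

definition axiom4 :: "real \<Rightarrow> real set \<Rightarrow> 'a pmf \<Rightarrow> (nat \<Rightarrow> 'a list pmf set) \<Rightarrow> bool" where
  "axiom4 B J P Qs \<longleftrightarrow>
     (\<exists>(U :: nat \<Rightarrow> 'a list pmf) (v :: real poly). \<forall>n\<ge>1.
        U n \<in> sym_dists n \<and>
        (\<forall>Q\<in>Qs n \<inter> sym_dists n. \<forall>xs\<in>words n. pmf Q xs \<le> poly v (real n) * pmf (U n) xs) \<and>
        (\<forall>s\<in>J. renyi_div B s (replicate_pmf n P) (U n)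
                  \<ge> renyi_div_set B s (replicate_pmf n P) (Qs n))) \<and>
     (\<forall>n\<ge>1. \<forall>p\<in>Qs n. symmetrize n p \<in> Qs n \<inter> sym_dists n)"

definition axiom5 ::
  "real \<Rightarrow> real set \<Rightarrow> 'a pmf \<Rightarrow> (nat \<Rightarrow> 'a list pmf set) \<Rightarrow> 'v::euclidean_space set
     \<Rightarrow> ('v \<Rightarrow> 'a pmf) \<Rightarrow> bool" where
  "axiom5 B J P Qs \<Theta> Q\<^sub>\<Theta> \<longleftrightarrow>
     compact \<Theta> \<and> convex \<Theta> \<and>
     (\<forall>x. C2_on (\<lambda>\<theta>. pmf (Q\<^sub>\<Theta> \<theta>) x) \<Theta>) \<and>
     single_letter Qs = Q\<^sub>\<Theta> ` \<Theta> \<and>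
     (\<forall>s\<in>J. \<exists>\<theta>\<^sub>s.
        (\<forall>\<theta>. is_arg_min (\<lambda>\<theta>. renyi_div B s P (Q\<^sub>\<Theta> \<theta>)) (\<lambda>\<theta>. \<theta> \<in> \<Theta>) \<theta> \<longleftrightarrow> \<theta> = \<theta>\<^sub>s) \<and>
        \<theta>\<^sub>s \<in> rel_interior \<Theta> \<and>
        (s < 1 \<longrightarrow> neg_def_hessian (\<lambda>\<theta>. renyi_g s P (Q\<^sub>\<Theta> \<theta>)) \<theta>\<^sub>s \<Theta>) \<and>
        (s > 1 \<longrightarrow> pos_def_hessian (\<lambda>\<theta>. renyi_g s P (Q\<^sub>\<Theta> \<theta>)) \<theta>\<^sub>s \<Theta>) \<and>
        (s = 1 \<longrightarrow> pos_def_hessian (\<lambda>\<theta>. renyi_div B 1 P (Q\<^sub>\<Theta> \<theta>)) \<theta>\<^sub>s \<Theta>))"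

end

theory Submission
  imports Defs
begin

text \<open>
  Everything is expressed through the moment \<open>E\<^sub>P[(k Q / P)\<^sup>t]\<close> with \<open>k = B powr c\<close>. It equals 1 at
  \<open>t = 0\<close> with slope \<open>ln B * (c - D(P\<parallel>Q))\<close> there, so it drops below 1 for small \<open>t > 0\<close> if
  \<open>c < D(P\<parallel>Q)\<close> and for small \<open>t < 0\<close> if \<open>c > D(P\<parallel>Q)\<close>; for \<open>0 < t < 1\<close>, being at most 1 means
  \<open>D\<^sub>1\<^sub>-\<^sub>t(P\<parallel>Q) \<ge> c\<close>. For the lower bound on the threshold rate, compactness of \<open>\<Theta>\<close> gives one
  \<open>s < 1\<close> with \<open>D\<^sub>s(P\<parallel>Q\<^sub>\<theta>) \<ge> c\<close> for all \<open>\<theta>\<close>; Axioms 3 and 4 transfer this to \<open>U\<^sup>n\<close>, and the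
  likelihood ratio test against \<open>U\<^sup>n\<close> is permutation invariant, so its error under \<open>\<Q>\<^sub>n\<close> is that
  under the symmetric members of \<open>\<Q>\<^sub>n\<close>. For the strong converse, a single \<open>Q\<close> with
  \<open>D(P\<parallel>Q) < c\<close> suffices, since its powers lie in \<open>\<Q>\<^sub>n\<close> by Axiom 2.
\<close>

section \<open>Moments of the likelihood ratio on a single alphabet\<close>

definition lr_moment :: "real \<Rightarrow> 'a pmf \<Rightarrow> 'a pmf \<Rightarrow> real \<Rightarrow> real" where
  "lr_moment k P Q t = (\<Sum>x\<in>set_pmf P. pmf P x * (k * pmf Q x / pmf P x) powr t)"

text \<open>By concavity, \<open>z powr r\<close> lies below its tangent at
  \<open>z = 1\<close>.\<close>

lemma powr_le_affine:
  fixes z r :: real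
  assumes "0 \<le> z" "0 \<le> r" "r \<le> 1"
  shows "z powr r \<le> 1 - r + r * z"
proof (cases "z = 0")
  case False
  then show ?thesis
    using Youngs_inequality_0[of r "1 - r" z 1] assms by simp
qed (use assms in simp)

lemma sum_pmf_set_pmf:
  assumes "finite (set_pmf P)"
  shows "(\<Sum>x\<in>set_pmf P. pmf P x) = 1"
  using assms by (intro sum_pmf_eq_1) auto

text \<open>Jensen's inequality for the concave power \<open>r = t' / t\<close>, with total mass 1.
  It allows finitely many exponents to be replaced by their minimum.\<close>

lemma lr_moment_less_one_mono:
  assumes fin: "finite (set_pmf P)" and "0 \<le> k"
    and t: "0 < t'" "t' \<le> t" and less: "lr_moment k P Q t < 1"
  shows "lr_moment k P Q t' < 1"
proof -
  define r where "r = t' / t"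
  have r: "0 < r" "r \<le> 1" and t': "t' = t * r"
    using t by (auto simp: r_def)
  have "lr_moment k P Q t' \<le> (\<Sum>x\<in>set_pmf P. pmf P x * (1 - r + r * (k * pmf Q x / pmf P x) powr t))"
    unfolding lr_moment_def t' powr_powr[symmetric]
    using r \<open>0 \<le> k\<close> by (intro sum_mono mult_left_mono powr_le_affine) auto
  also have "\<dots> = (1 - r) * (\<Sum>x\<in>set_pmf P. pmf P x) + r * lr_moment k P Q t"
    by (simp add: lr_moment_def sum_distrib_left sum.distrib[symmetric] algebra_simps)
  also have "\<dots> < 1"
    using r less by (simp add: sum_pmf_set_pmf[OF fin])
  finally show ?thesis .
qed

text \<open>Each summand is an exponential in \<open>t\<close> whose slope at 0 is the logarithm of
  the ratio, weighted by \<open>pmf P x\<close>; the condition on supports keeps all ratios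
  positive.\<close>

lemma DERIV_lr_moment_0:
  assumes fin: "finite (set_pmf P)" and B: "B > 1"
    and supp: "\<And>x. pmf P x > 0 \<Longrightarrow> pmf Q x > 0"
  shows "DERIV (lr_moment (B powr c) P Q) 0 :>
    ln B * (c - (\<Sum>x\<in>set_pmf P. pmf P x * (log B (pmf P x) - log B (pmf Q x))))"
proof -
  let ?Z = "\<lambda>x. B powr c * pmf Q x / pmf P x"
  have Z: "?Z x > 0" if "x \<in> set_pmf P" for x
    using that supp B by (simp add: pmf_positive)
  have "DERIV (\<lambda>t. \<Sum>x\<in>set_pmf P. pmf P x * ?Z x powr t) 0 :> (\<Sum>x\<in>set_pmf P. pmf P x * ln (?Z x))"
  proof (intro DERIV_sum)
    fix x assume "x \<in> set_pmf P"
    then show "DERIV (\<lambda>t. pmf P x * ?Z x powr t) 0 :> pmf P x * ln (?Z x)"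
      using Z[of x] by (auto intro!: derivative_eq_intros)
  qed
  moreover have "(\<Sum>x\<in>set_pmf P. pmf P x * ln (?Z x)) =
      ln B * (c * (\<Sum>x\<in>set_pmf P. pmf P x) - (\<Sum>x\<in>set_pmf P. pmf P x * (log B (pmf P x) - log B (pmf Q x))))"
    unfolding sum_distrib_left sum_subtractf[symmetric]
  proof (intro sum.cong refl)
    fix x assume "x \<in> set_pmf P"
    then have "pmf P x > 0" "pmf Q x > 0"
      using supp by (auto simp: pmf_positive)
    then have "ln (?Z x) = c * ln B + ln (pmf Q x) - ln (pmf P x)"
      using B by (simp add: ln_div ln_mult ln_powr)
    then show "pmf P x * ln (?Z x) = ln B * (c * pmf P x - pmf P x * (log B (pmf P x) - log B (pmf Q x)))"
      using B by (simp only: log_def) (simp add: field_simps)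
  qed
  ultimately show ?thesis
    by (simp add: sum_pmf_set_pmf[OF fin] lr_moment_def[abs_def])
qed

lemma lr_moment_0:
  assumes "finite (set_pmf P)" "k > 0" "\<And>x. pmf P x > 0 \<Longrightarrow> pmf Q x > 0"
  shows "lr_moment k P Q 0 = 1"
proof -
  have "lr_moment k P Q 0 = (\<Sum>x\<in>set_pmf P. pmf P x)"
    unfolding lr_moment_def
  proof (intro sum.cong refl)
    fix x assume "x \<in> set_pmf P"
    then have "pmf P x > 0" "pmf Q x > 0"
      using assms(3) by (auto simp: pmf_positive)
    then show "pmf P x * (k * pmf Q x / pmf P x) powr 0 = pmf P x"
      using assms(2) by simp
  qed
  then show ?thesis
    using assms(1) by (simp add: sum_pmf_set_pmf)
qed

text \<open>With finite divergence the moment is 1 at 0 and has negative slope there. With infinite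
  divergence it already jumps below 1 as \<open>t\<close> tends to 0 from the right.\<close>

lemma lr_moment_less_one_right:
  assumes fin: "finite (set_pmf P)" and B: "B > 1" and c: "ereal c < rel_entropy B P Q"
  shows "\<exists>t>0. lr_moment (B powr c) P Q t < 1"
proof (cases "\<exists>x. pmf P x > 0 \<and> pmf Q x = 0")
  case True
  then obtain y where y: "y \<in> set_pmf P" "pmf Q y = 0"
    by (metis less_irrefl set_pmf_iff)
  let ?Z = "\<lambda>x. B powr c * pmf Q x / pmf P x"
  \<comment> \<open>Letters with \<open>pmf Q x = 0\<close> contribute 0 for every
    \<open>t > 0\<close>, so the limit is the \<open>P\<close>-mass of the support of
    \<open>Q\<close>; the letter \<open>y\<close> makes it strictly less than 1.\<close>
  let ?l = "\<lambda>x. if pmf Q x = 0 then 0 else pmf P x"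
  have "((\<lambda>t. \<Sum>x\<in>set_pmf P. pmf P x * ?Z x powr t) \<longlongrightarrow> (\<Sum>x\<in>set_pmf P. ?l x)) (at_right 0)"
  proof (intro tendsto_sum)
    fix x assume x: "x \<in> set_pmf P"
    show "((\<lambda>t. pmf P x * ?Z x powr t) \<longlongrightarrow> ?l x) (at_right 0)"
    proof (cases "pmf Q x = 0")
      case False
      then have "?Z x > 0"
        using x B by (auto simp: pmf_positive pmf_pos intro!: divide_pos_pos mult_pos_pos)
      then have "((\<lambda>t. pmf P x * ?Z x powr t) \<longlongrightarrow> pmf P x * ?Z x powr 0) (at_right 0)"
        by (intro tendsto_intros) auto
      then show ?thesis
        using False x B by (simp add: set_pmf_iff)
    qed simp
  qed
  moreover have "(\<Sum>x\<in>set_pmf P. ?l x) < (\<Sum>x\<in>set_pmf P. pmf P x)"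
    using fin y by (intro sum_strict_mono_ex1) (auto simp: pmf_positive intro!: bexI[of _ y])
  ultimately have "\<forall>\<^sub>F t in at_right 0. lr_moment (B powr c) P Q t < 1"
    unfolding lr_moment_def sum_pmf_set_pmf[OF fin] by (rule order_tendstoD(2))
  then show ?thesis
    using eventually_happens'[OF trivial_limit_at_right_real eventually_conj[OF eventually_at_right_less]]
    by blast
next
  case False
  then have supp: "pmf Q x > 0" if "pmf P x > 0" for x
    using that by (metis pmf_nonneg less_eq_real_def)
  have "ln B * (c - (\<Sum>x\<in>set_pmf P. pmf P x * (log B (pmf P x) - log B (pmf Q x)))) < 0"
    using c False B by (intro mult_pos_neg) (auto simp: rel_entropy_def split: if_splits)
  from DERIV_neg_dec_right[OF DERIV_lr_moment_0[OF fin B supp] this]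
  obtain d where "d > 0"
    and d: "\<And>h. 0 < h \<Longrightarrow> h < d \<Longrightarrow> lr_moment (B powr c) P Q h < lr_moment (B powr c) P Q 0"
    by auto
  have "lr_moment (B powr c) P Q (d / 2) < 1"
    using d[of "d / 2"] \<open>d > 0\<close> lr_moment_0[OF fin _ supp, of "B powr c"] B by simp
  then show ?thesis
    using \<open>d > 0\<close> by (intro exI[of _ "d / 2"]) simp
qed

lemma lr_moment_less_one_left:
  assumes fin: "finite (set_pmf P)" and B: "B > 1" and c: "rel_entropy B P Q < ereal c"
  shows "\<exists>t>0. lr_moment (B powr c) P Q (- t) < 1"
proof -
  \<comment> \<open>A divergence below a real number is finite, so the support condition for the
    derivative holds automatically.\<close>
  have nex: "\<not> (\<exists>x. pmf P x > 0 \<and> pmf Q x = 0)"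
    using c by (cases "\<exists>x. pmf P x > 0 \<and> pmf Q x = 0") (simp_all add: rel_entropy_def)
  then have supp: "pmf Q x > 0" if "pmf P x > 0" for x
    using that by (metis pmf_nonneg less_eq_real_def)
  have "0 < ln B * (c - (\<Sum>x\<in>set_pmf P. pmf P x * (log B (pmf P x) - log B (pmf Q x))))"
    using c nex B by (intro mult_pos_pos) (auto simp: rel_entropy_def split: if_splits)
  from DERIV_pos_inc_left[OF DERIV_lr_moment_0[OF fin B supp] this]
  obtain d where "d > 0"
    and d: "\<And>h. 0 < h \<Longrightarrow> h < d \<Longrightarrow> lr_moment (B powr c) P Q (- h) < lr_moment (B powr c) P Q 0"
    by auto
  have "lr_moment (B powr c) P Q (- (d / 2)) < 1"
    using d[of "d / 2"] \<open>d > 0\<close> lr_moment_0[OF fin _ supp, of "B powr c"] B by simp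
  then show ?thesis
    using \<open>d > 0\<close> by (intro exI[of _ "d / 2"]) simp
qed

lemma lr_moment_eq_powr_mult:
  assumes "0 \<le> k"
  shows "lr_moment k P Q t = k powr t * (\<Sum>x\<in>set_pmf P. pmf P x powr (1 - t) * pmf Q x powr t)"
  unfolding lr_moment_def sum_distrib_left
proof (intro sum.cong refl)
  fix x assume "x \<in> set_pmf P"
  then have "pmf P x > 0"
    by (rule pmf_positive)
  then show "pmf P x * (k * pmf Q x / pmf P x) powr t = k powr t * (pmf P x powr (1 - t) * pmf Q x powr t)"
    using assms by (simp add: powr_divide powr_mult powr_diff)
qed

text \<open>For \<open>s < 1\<close> the factor \<open>1 / (s - 1)\<close> is negative, so a lower
  bound on the divergence is an upper bound on \<open>renyi_g\<close>.\<close>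

lemma renyi_div_ge_iff:
  assumes "B > 1" "s < 1"
  shows "ereal c \<le> renyi_div B s P Q \<longleftrightarrow> lr_moment (B powr c) P Q (1 - s) \<le> 1"
proof -
  define g where "g = (\<Sum>x\<in>set_pmf P. pmf P x powr s * pmf Q x powr (1 - s))"
  have g: "renyi_g s P Q = ereal g"
    using assms by (simp add: renyi_g_def g_def)
  have m: "lr_moment (B powr c) P Q (1 - s) = B powr (c * (1 - s)) * g"
    using lr_moment_eq_powr_mult[of "B powr c" P Q "1 - s"] by (simp add: g_def powr_powr)
  have "g \<ge> 0"
    by (simp add: g_def sum_nonneg)
  show ?thesis
  proof (cases "g = 0")
    \<comment> \<open>Disjoint supports: the divergence is infinite and the moment is 0, so both
      sides hold.\<close>
    case True
    then show ?thesis
      using assms by (simp add: renyi_div_def g m elog_def zero_ereal_def)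
  next
    case False
    with \<open>g \<ge> 0\<close> have "g > 0" by simp
    then have "ereal c \<le> renyi_div B s P Q \<longleftrightarrow> c \<le> 1 / (s - 1) * log B g"
      using assms by (simp add: renyi_div_def g elog_def zero_ereal_def)
    also have "\<dots> \<longleftrightarrow> log B g \<le> - (c * (1 - s))"
      using assms by (simp add: field_simps)
    also have "\<dots> \<longleftrightarrow> g \<le> B powr (- (c * (1 - s)))"
      using assms \<open>g > 0\<close> by (simp add: log_le_iff)
    also have "\<dots> \<longleftrightarrow> B powr (c * (1 - s)) * g \<le> 1"
      using assms unfolding powr_minus by (simp add: pos_le_divide_eq inverse_eq_divide mult.commute)
    finally show ?thesis
      by (simp add: m)
  qed
qed

section \<open>Words, product distributions and permutations\<close>

lemma finite_words: "finite (words n :: 'a::finite list set)"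
  using finite_lists_length_eq[of "UNIV :: 'a set" n] by (simp add: words_def)

lemma words_Suc: "words (Suc n) = (\<lambda>(x, xs). x # xs) ` (UNIV \<times> words n)"
  by (auto simp: words_def length_Suc_conv image_iff)

lemma sum_words_prod:
  fixes f :: "'a::finite \<Rightarrow> real"
  shows "(\<Sum>xs\<in>words n. \<Prod>i<n. f (xs ! i)) = (\<Sum>x\<in>UNIV. f x) ^ n"
proof (induction n)
  case 0
  then show ?case by (simp add: words_def)
next
  case (Suc n)
  have "inj_on (\<lambda>(x :: 'a, xs). x # xs) (UNIV \<times> words n)"
    by (auto simp: inj_on_def)
  then have "(\<Sum>xs\<in>words (Suc n). \<Prod>i<Suc n. f (xs ! i)) =
      (\<Sum>(x, xs)\<in>UNIV \<times> words n. f x * (\<Prod>i<n. f (xs ! i)))"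
    by (simp add: words_Suc sum.reindex case_prod_unfold prod.lessThan_Suc_shift del: prod.lessThan_Suc)
  also have "\<dots> = (\<Sum>x\<in>UNIV. f x) * (\<Sum>xs\<in>words n. \<Prod>i<n. f (xs ! i))"
    by (simp add: sum.cartesian_product[symmetric] sum_product)
  finally show ?case
    by (simp add: Suc.IH)
qed

lemma sum_pmf_words:
  fixes p :: "'a::finite list pmf"
  assumes "p \<in> dists n"
  shows "(\<Sum>xs\<in>words n. pmf p xs) = 1"
  using assms by (intro sum_pmf_eq_1 finite_words) (simp add: dists_def)

lemma replicate_pmf_in_dists: "replicate_pmf n P \<in> dists n"
  by (auto simp: dists_def words_def set_replicate_pmf)

lemma lr_moment_words:
  fixes p :: "'a::finite list pmf"
  assumes "p \<in> dists n"
  shows "lr_moment k p q t = (\<Sum>xs\<in>words n. pmf p xs * (k * pmf q xs / pmf p xs) powr t)"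
  unfolding lr_moment_def using assms
  by (intro sum.mono_neutral_left finite_words) (auto simp: dists_def set_pmf_iff)

text \<open>The likelihood ratio of product distributions factorizes over the letters. A
  single-letter moment below 1 thus decays exponentially in \<open>n\<close>.\<close>

lemma lr_moment_replicate:
  fixes P Q :: "'a::finite pmf"
  assumes "0 \<le> k"
  shows "lr_moment (k ^ n) (replicate_pmf n P) (replicate_pmf n Q) t = lr_moment k P Q t ^ n"
proof -
  let ?f = "\<lambda>x. pmf P x * (k * pmf Q x / pmf P x) powr t"
  have "lr_moment (k ^ n) (replicate_pmf n P) (replicate_pmf n Q) t = (\<Sum>xs\<in>words n. \<Prod>i<n. ?f (xs ! i))"
    unfolding lr_moment_words[OF replicate_pmf_in_dists]
  proof (intro sum.cong refl)
    fix xs :: "'a list" assume "xs \<in> words n"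
    then show "pmf (replicate_pmf n P) xs *
        (k ^ n * pmf (replicate_pmf n Q) xs / pmf (replicate_pmf n P) xs) powr t = (\<Prod>i<n. ?f (xs ! i))"
      using assms prod_powr_distrib[of "\<lambda>i. k * pmf Q (xs ! i) / pmf P (xs ! i)" "{..<n}" t]
      by (simp add: pmf_replicate_pmf_words prod.distrib prod_dividef)
  qed
  also have "\<dots> = (\<Sum>x\<in>UNIV. ?f x) ^ n"
    by (rule sum_words_prod)
  also have "(\<Sum>x\<in>UNIV. ?f x) = lr_moment k P Q t"
    unfolding lr_moment_def by (intro sum.mono_neutral_right) (auto simp: set_pmf_iff)
  finally show ?thesis .
qed

lemma permute_list_bij_words:
  assumes "\<pi> permutes {..<n}"
  shows "bij_betw (permute_list \<pi>) (words n) (words n)"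
proof (rule bij_betw_byWitness)
  have inv: "inv \<pi> permutes {..<n}"
    using assms by (rule permutes_inv)
  show "\<forall>xs\<in>words n. permute_list (inv \<pi>) (permute_list \<pi> xs) = xs"
    using permute_list_compose[of "inv \<pi>" _ \<pi>] inv permutes_inv_o(1)[OF assms]
    by (metis (mono_tags) mem_Collect_eq permute_list_id words_def)
  show "\<forall>xs\<in>words n. permute_list \<pi> (permute_list (inv \<pi>) xs) = xs"
    using permute_list_compose[of \<pi> _ "inv \<pi>"] assms permutes_inv_o(2)[OF assms]
    by (metis (mono_tags) mem_Collect_eq permute_list_id words_def)
qed (auto simp: words_def)

lemma pmf_replicate_permute_list:
  assumes "\<pi> permutes {..<n}" "xs \<in> words n"
  shows "pmf (replicate_pmf n P) (permute_list \<pi> xs) = pmf (replicate_pmf n P) xs"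
proof -
  have len: "length xs = n"
    using assms(2) by (simp add: words_def)
  have "pmf (replicate_pmf n P) (permute_list \<pi> xs) = (\<Prod>i<n. pmf P (xs ! \<pi> i))"
    using assms len by (subst pmf_replicate_pmf_words) (auto simp: words_def permute_list_nth intro!: prod.cong)
  also have "\<dots> = (\<Prod>i<n. pmf P (xs ! i))"
    using prod.permute[OF assms(1), of "\<lambda>i. pmf P (xs ! i)"] by (simp add: comp_def)
  finally show ?thesis
    using assms(2) by (simp add: pmf_replicate_pmf_words)
qed

lemma pmf_sym_permute_list:
  assumes "p \<in> sym_dists n" "\<pi> permutes {..<n}" "xs \<in> words n"
  shows "pmf p (permute_list \<pi> xs) = pmf p xs"
  using pmf_permute_pmf[of p n \<pi> xs] assms by (simp add: sym_dists_def)

text \<open>An invariant \<open>T\<close> can be permuted along with the mass; every permutation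
  then merely reindexes the sum over words, so averaging changes nothing.\<close>

lemma sum_symmetrize:
  fixes p :: "'a::finite list pmf"
  assumes p: "p \<in> dists n"
    and T: "\<And>\<pi> xs. \<pi> permutes {..<n} \<Longrightarrow> xs \<in> words n \<Longrightarrow> T (permute_list \<pi> xs) = T xs"
  shows "(\<Sum>xs\<in>words n. pmf (symmetrize n p) xs * T xs) = (\<Sum>xs\<in>words n. pmf p xs * T xs)"
proof -
  let ?S = "{\<pi>. \<pi> permutes {..<n}}"
  have "(\<Sum>xs\<in>words n. pmf (symmetrize n p) xs * T xs) =
      (\<Sum>xs\<in>words n. \<Sum>\<pi>\<in>?S. pmf p (permute_list \<pi> xs) * T (permute_list \<pi> xs)) / fact n"
    using T by (simp add: pmf_symmetrize[OF p] sum_divide_distrib sum_distrib_right)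
  also have "\<dots> = (\<Sum>\<pi>\<in>?S. \<Sum>xs\<in>words n. pmf p (permute_list \<pi> xs) * T (permute_list \<pi> xs)) / fact n"
    by (subst sum.swap) simp
  also have "\<dots> = (\<Sum>\<pi>\<in>?S. \<Sum>xs\<in>words n. pmf p xs * T xs) / fact n"
    using sum.reindex_bij_betw[OF permute_list_bij_words, of _ n "\<lambda>xs. pmf p xs * T xs"] by simp
  also have "\<dots> = (\<Sum>xs\<in>words n. pmf p xs * T xs)"
    by (simp add: card_permutations[OF card_lessThan])
  finally show ?thesis .
qed

section \<open>Error bounds and the minimal type 1 error\<close>

text \<open>Markov's inequality for the likelihood ratio; the next lemma uses it with exponent \<open>- t\<close>.\<close>

lemma type1_error_threshold_le:
  fixes p :: "'a::finite list pmf"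
  assumes p: "p \<in> dists n" and "0 < k" "0 \<le> r" "0 < t"
  shows "type1_error n (\<lambda>xs. if pmf p xs > r * k * pmf q xs then 1 else 0) p \<le> r powr t * lr_moment k p q t"
  unfolding type1_error_def lr_moment_words[OF p] sum_distrib_left
proof (rule sum_mono)
  fix xs :: "'a list"
  show "pmf p xs * (1 - (if pmf p xs > r * k * pmf q xs then 1 else 0))
      \<le> r powr t * (pmf p xs * (k * pmf q xs / pmf p xs) powr t)"
  proof (cases "pmf p xs > 0 \<and> pmf p xs \<le> r * k * pmf q xs")
    case True
    \<comment> \<open>These are the words of positive mass that the test rejects; there the rescaled
      ratio is at least 1 and so is its \<open>t\<close>-th power. All other words contribute 0 on
      the left.\<close>
    then have "1 \<le> r * (k * pmf q xs / pmf p xs)"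
      by (simp add: field_simps)
    then have "1 \<le> (r * (k * pmf q xs / pmf p xs)) powr t"
      using assms by (intro ge_one_powr_ge_zero) auto
    then have "pmf p xs * 1 \<le> pmf p xs * (r * (k * pmf q xs / pmf p xs)) powr t"
      by (intro mult_left_mono) auto
    also have "\<dots> = r powr t * (pmf p xs * (k * pmf q xs / pmf p xs) powr t)"
      using assms by (subst powr_mult) auto
    finally show ?thesis
      using True by auto
  next
    case False
    then show ?thesis
      using assms pmf_nonneg[of p xs] by auto
  qed
qed

lemma type1_error_ge:
  fixes p :: "'a::finite list pmf"
  assumes p: "p \<in> dists n" and T: "is_test n T" and "0 \<le> k" "0 < t"
    and supp: "\<And>xs. pmf p xs > 0 \<Longrightarrow> k * pmf q xs > 0"
  shows "1 - lr_moment k p q (- t) - k * (\<Sum>xs\<in>words n. pmf q xs * T xs) \<le> type1_error n T p"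
proof -
  have "(\<Sum>xs\<in>words n. pmf p xs * T xs) \<le>
      (\<Sum>xs\<in>words n. pmf p xs * (k * pmf q xs / pmf p xs) powr (- t) + k * (pmf q xs * T xs))"
  proof (rule sum_mono)
    fix xs :: "'a list" assume "xs \<in> words n"
    then have T01: "0 \<le> T xs" "T xs \<le> 1"
      using T by (auto simp: is_test_def)
    \<comment> \<open>Where the ratio is at least 1, mass under \<open>p\<close> is bounded by
      \<open>k\<close> times mass under \<open>q\<close>; where it is below 1, its power with
      exponent \<open>- t\<close> is at least 1.\<close>
    consider "pmf p xs = 0" | "pmf p xs > 0" "pmf p xs \<le> k * pmf q xs" | "pmf p xs > 0" "k * pmf q xs < pmf p xs"
      using pmf_nonneg[of p xs] by linarith
    then show "pmf p xs * T xs \<le> pmf p xs * (k * pmf q xs / pmf p xs) powr (- t) + k * (pmf q xs * T xs)"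
    proof cases
      case 1
      then show ?thesis using T01 assms by simp
    next
      case 2
      then have "pmf p xs * T xs \<le> k * pmf q xs * T xs"
        using T01 by (intro mult_right_mono)
      then show ?thesis by (simp add: mult.assoc add_increasing)
    next
      case 3
      have "1 \<le> (k * pmf q xs / pmf p xs) powr (- t)"
      proof -
        have "(k * pmf q xs / pmf p xs) powr t \<le> 1 powr t"
          using 3 supp[of xs] assms by (intro powr_mono2) auto
        \<comment> \<open>Positivity of the ratio comes from \<open>supp\<close>. It is essential
          since \<open>0 powr (- t)\<close> is 0 by convention, not infinite.\<close>
        moreover have "0 < (k * pmf q xs / pmf p xs) powr t"
          using 3(1) supp[OF 3(1)] unfolding powr_gt_zero by (metis divide_pos_pos less_irrefl)
        ultimately show ?thesis
          unfolding powr_minus by (intro one_le_inverse) auto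
      qed
      then have "pmf p xs * T xs \<le> pmf p xs * (k * pmf q xs / pmf p xs) powr (- t)"
        using T01 by (intro mult_left_mono) auto
      then show ?thesis
        using T01 assms by (simp add: add_increasing2)
    qed
  qed
  then show ?thesis
    using sum_pmf_words[OF p]
    by (simp add: type1_error_def lr_moment_words[OF p] sum.distrib sum_distrib_left right_diff_distrib sum_subtractf)
qed

lemma min_type1_nonneg: "0 \<le> min_type1 n \<mu> p \<Q>"
  unfolding min_type1_def
  by (intro INF_greatest) (auto simp: type1_error_def is_test_def intro!: sum_nonneg mult_nonneg_nonneg)

lemma min_type1_le:
  assumes "is_test n T" "type2_error n T \<Q> \<le> ereal \<mu>"
  shows "min_type1 n \<mu> p \<Q> \<le> ereal (type1_error n T p)"
  unfolding min_type1_def using assms by (intro INF_lower) simp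

lemma min_type1_antimono:
  assumes "\<mu> \<le> \<nu>"
  shows "min_type1 n \<nu> p \<Q> \<le> min_type1 n \<mu> p \<Q>"
  unfolding min_type1_def
  using assms by (intro INF_superset_mono) (auto intro: order_trans)

lemma min_type1_le_1:
  fixes p :: "'a::finite list pmf"
  assumes "p \<in> dists n" "0 \<le> \<mu>"
  shows "min_type1 n \<mu> p \<Q> \<le> 1"
proof -
  have "type2_error n (\<lambda>_. 0) \<Q> \<le> ereal \<mu>"
    unfolding type2_error_def using assms by (intro SUP_least) simp
  then have "min_type1 n \<mu> p \<Q> \<le> ereal (type1_error n (\<lambda>_. 0) p)"
    by (intro min_type1_le) (simp add: is_test_def)
  then show ?thesis
    using sum_pmf_words[OF assms(1)] by (simp add: type1_error_def one_ereal_def)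
qed

text \<open>This absorbs the polynomial factor of \<open>axiom4\<close> into an exponential
  decay.\<close>

lemma poly_times_power_tendsto_0:
  fixes v :: "real poly" and q :: real
  assumes "0 < q" "q < 1"
  shows "(\<lambda>n. poly v (real n) * q ^ n) \<longlonglongrightarrow> 0"
  using assms
proof (induction v arbitrary: q)
  case 0
  then show ?case by simp
next
  case (pCons a v)
  \<comment> \<open>one factor \<open>r ^ n\<close> absorbs the extra \<open>n\<close>, the other goes to the induction hypothesis\<close>
  define r where "r = sqrt q"
  have r: "0 < r" "r < 1" and q: "q = r * r"
    using pCons.prems by (auto simp: r_def)
  have "(\<lambda>n. a * q ^ n + (real n * r ^ n) * (poly v (real n) * r ^ n)) \<longlonglongrightarrow> a * 0 + 0 * 0"
    using pCons.prems r
    by (intro tendsto_intros pCons.IH LIMSEQ_power_zero powser_times_n_limit_0) auto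
  then show ?case
    by (simp add: q power_mult_distrib algebra_simps)
qed

section \<open>Order of the threshold rates and the strong converse\<close>

text \<open>A larger rate tightens the constraint on the type 2 error. If \<open>R > R'\<close>, the
  errors for \<open>R\<close> would dominate those for \<open>R'\<close>, so their liminf would be
  at least 1 while their limsup is 0.\<close>

lemma R_th_le_R_th_star:
  assumes "B > 1"
  shows "R_th B P Qs \<le> R_th_star B P Qs"
  unfolding R_th_def R_th_star_def
proof (intro SUP_least INF_greatest)
  let ?m = "\<lambda>R n. min_type1 n (B powr (- real n * R)) (replicate_pmf n P) (Qs n)"
  fix R R' :: real
  assume R: "R \<in> {R. limsup (?m R) = 0}" and R': "R' \<in> {R. liminf (?m R) = 1}"
  show "ereal R \<le> ereal R'"
  proof (rule ccontr)
    assume "\<not> ereal R \<le> ereal R'"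
    then have "?m R' n \<le> ?m R n" for n
      using assms by (intro min_type1_antimono powr_mono) (auto simp: mult_left_mono)
    then have "liminf (?m R') \<le> liminf (?m R)"
      by (intro Liminf_mono) simp
    also have "\<dots> \<le> limsup (?m R)"
      by (intro Liminf_le_Limsup) simp
    finally show False
      using R R' by simp
  qed
qed

lemma R_th_star_le:
  fixes P :: "'a::finite pmf"
  assumes B: "B > 1" and ax: "axiom2 Qs"
  shows "R_th_star B P Qs \<le> renyi_div_set B 1 P (single_letter Qs)"
proof (rule ccontr)
  assume "\<not> ?thesis"
  then obtain R where R: "renyi_div_set B 1 P (single_letter Qs) < ereal R" "ereal R < R_th_star B P Qs"
    using ereal_dense2 by (meson not_le)
  \<comment> \<open>The gap between the divergence and \<open>c\<close> makes a moment with negative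
    exponent less than 1; the gap between \<open>c\<close> and \<open>R\<close> makes the type 2
    term decay after multiplication by \<open>B powr c\<close> to the power
    \<open>n\<close>.\<close>
  then obtain c where c: "renyi_div_set B 1 P (single_letter Qs) < ereal c" "c < R"
    using ereal_dense2 by (metis ereal_less_eq(3) not_le)
  then obtain Q where Q: "Q \<in> single_letter Qs" "rel_entropy B P Q < ereal c"
    by (auto simp: renyi_div_set_def renyi_div_def INF_less_iff)
  have fin: "finite (set_pmf P)" by simp
  obtain t where t: "t > 0" "lr_moment (B powr c) P Q (- t) < 1"
    using lr_moment_less_one_left[OF fin B Q(2)] by blast
  have supp: "set_pmf P \<subseteq> set_pmf Q"
    using Q(2) by (auto simp: rel_entropy_def set_pmf_iff pmf_pos split: if_splits)
  let ?h = "lr_moment (B powr c) P Q (- t)"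
  let ?m = "\<lambda>n. min_type1 n (B powr (- real n * R)) (replicate_pmf n P) (Qs n)"
  have lower: "ereal (1 - ?h ^ n - (B powr (c - R)) ^ n) \<le> ?m n" if "n \<ge> 1" for n
    unfolding min_type1_def
  proof (rule INF_greatest)
    fix T assume "T \<in> {T. is_test n T \<and> type2_error n T (Qs n) \<le> ereal (B powr (- real n * R))}"
    then have T: "is_test n T" and b: "type2_error n T (Qs n) \<le> ereal (B powr (- real n * R))"
      by auto
    let ?q = "replicate_pmf n Q" and ?k = "(B powr c) ^ n"
    have "?q \<in> Qs n"
      using ax Q(1) that by (auto simp: axiom2_def)
    then have "ereal (\<Sum>xs\<in>words n. pmf ?q xs * T xs) \<le> ereal (B powr (- real n * R))"
      using b unfolding type2_error_def by (meson SUP_upper order_trans)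
    then have beta: "(\<Sum>xs\<in>words n. pmf ?q xs * T xs) \<le> B powr (- real n * R)"
      by simp
    have "?k * (\<Sum>xs\<in>words n. pmf ?q xs * T xs) \<le> ?k * B powr (- real n * R)"
      using beta by (intro mult_left_mono) auto
    also have "\<dots> = (B powr (c - R)) ^ n"
      using B by (simp add: powr_realpow[symmetric] powr_powr powr_add[symmetric] algebra_simps)
    finally have 1: "?k * (\<Sum>xs\<in>words n. pmf ?q xs * T xs) \<le> (B powr (c - R)) ^ n" .
    \<comment> \<open>Inclusion of supports passes from letters to words, as
      \<open>type1_error_ge\<close> requires.\<close>
    have "pmf ?q xs > 0" if "pmf (replicate_pmf n P) xs > 0" for xs
    proof -
      have "xs \<in> set_pmf (replicate_pmf n P)"
        using that by (simp add: set_pmf_iff)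
      then have "set xs \<subseteq> set_pmf P" "length xs = n"
        by (auto simp: set_replicate_pmf)
      then have "xs \<in> set_pmf ?q"
        using supp by (auto simp: set_replicate_pmf)
      then show ?thesis
        by (rule pmf_positive)
    qed
    then have "1 - lr_moment ?k (replicate_pmf n P) ?q (- t) - ?k * (\<Sum>xs\<in>words n. pmf ?q xs * T xs)
        \<le> type1_error n T (replicate_pmf n P)"
      using B t by (intro type1_error_ge replicate_pmf_in_dists T) auto
    then show "ereal (1 - ?h ^ n - (B powr (c - R)) ^ n) \<le> ereal (type1_error n T (replicate_pmf n P))"
      using 1 by (simp add: lr_moment_replicate)
  qed
  have "?h \<ge> 0"
    by (simp add: lr_moment_def sum_nonneg)
  have "B powr (c - R) < 1"
    using B c(2) by (simp add: powr_less_one)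
  then have "(\<lambda>n. 1 - ?h ^ n - (B powr (c - R)) ^ n) \<longlonglongrightarrow> 1 - 0 - 0"
    using t \<open>?h \<ge> 0\<close> by (intro tendsto_intros LIMSEQ_power_zero) auto
  then have "(\<lambda>n. ereal (1 - ?h ^ n - (B powr (c - R)) ^ n)) \<longlonglongrightarrow> 1"
    by (simp add: one_ereal_def)
  then have "?m \<longlonglongrightarrow> 1"
  proof (rule tendsto_sandwich[rotated 2])
    show "\<forall>\<^sub>F n in sequentially. ereal (1 - ?h ^ n - (B powr (c - R)) ^ n) \<le> ?m n"
      using lower by (intro eventually_sequentiallyI[of 1])
    show "\<forall>\<^sub>F n in sequentially. ?m n \<le> 1"
      by (intro always_eventually allI min_type1_le_1 replicate_pmf_in_dists) simp
  qed simp
  then have "liminf ?m = 1"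
    by (intro lim_imp_Liminf) auto
  then have "R_th_star B P Qs \<le> ereal R"
    unfolding R_th_star_def by (intro INF_lower) simp
  with R(2) show False by simp
qed

section \<open>A uniform order below 1 by compactness\<close>

lemma C2_on_imp_continuous_on:
  assumes "C2_on f S"
  shows "continuous_on S f"
  using assms unfolding C2_on_def continuous_on_eq_continuous_within
  by (blast intro: has_derivative_continuous)

text \<open>Each parameter has an exponent whose moment is below 1, and this exponent still works
  nearby. A finite subcover leaves finitely many exponents, and their minimum works for all of
  \<Theta>.\<close>

lemma renyi_div_set_left_limit:
  fixes P :: "'a::finite pmf" and Q :: "'v::euclidean_space \<Rightarrow> 'a pmf"
  assumes B: "B > 1" and cpt: "compact \<Theta>" and cont: "\<And>x. continuous_on \<Theta> (\<lambda>\<theta>. pmf (Q \<theta>) x)"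
    and c: "ereal c < renyi_div_set B 1 P (Q ` \<Theta>)" and a: "a < 1"
  obtains s where "a < s" "0 < s" "s < 1" "ereal c \<le> renyi_div_set B s P (Q ` \<Theta>)"
proof -
  let ?h = "\<lambda>\<theta>. lr_moment (B powr c) P (Q \<theta>)"
  have fin: "finite (set_pmf P)" by simp
  have "\<exists>t>0. ?h \<theta> t < 1" if "\<theta> \<in> \<Theta>" for \<theta>
  proof (rule lr_moment_less_one_right[OF fin B])
    show "ereal c < rel_entropy B P (Q \<theta>)"
      using less_INF_D[OF c[unfolded renyi_div_set_def], of "Q \<theta>"] that by (simp add: renyi_div_def)
  qed
  then obtain t where t: "\<And>\<theta>. \<theta> \<in> \<Theta> \<Longrightarrow> t \<theta> > 0" "\<And>\<theta>. \<theta> \<in> \<Theta> \<Longrightarrow> ?h \<theta> (t \<theta>) < 1"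
    by metis
  have "\<exists>U. open U \<and> U \<inter> \<Theta> = {\<theta>'\<in>\<Theta>. ?h \<theta>' (t \<theta>) < 1}" if "\<theta> \<in> \<Theta>" for \<theta>
  proof -
    \<comment> \<open>The exponent stays fixed at \<open>t \<theta>\<close> while the parameter
      varies. As it is positive, the power is continuous even where the mass of a letter
      vanishes.\<close>
    have "continuous_on \<Theta> (\<lambda>\<theta>'. ?h \<theta>' (t \<theta>))"
      unfolding lr_moment_def using t(1)[OF that]
      by (intro continuous_on_sum continuous_on_mult continuous_on_const continuous_on_powr'
          continuous_on_divide cont) (auto simp: set_pmf_iff)
    then have "openin (top_of_set \<Theta>) (\<Theta> \<inter> (\<lambda>\<theta>'. ?h \<theta>' (t \<theta>)) -` {..<1})"
      by (intro continuous_openin_preimage_gen) auto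
    then show ?thesis
      unfolding openin_open by (auto simp: vimage_def Int_def conj_commute)
  qed
  then obtain U where U: "\<And>\<theta>. \<theta> \<in> \<Theta> \<Longrightarrow> open (U \<theta>)"
    "\<And>\<theta>. \<theta> \<in> \<Theta> \<Longrightarrow> U \<theta> \<inter> \<Theta> = {\<theta>'\<in>\<Theta>. ?h \<theta>' (t \<theta>) < 1}"
    by metis
  have "\<Theta> \<subseteq> (\<Union>\<theta>\<in>\<Theta>. U \<theta>)"
    using U(2) t(2) by blast
  from compactE_image[OF cpt _ this] U(1)
  obtain F where F: "F \<subseteq> \<Theta>" "finite F" "\<Theta> \<subseteq> (\<Union>\<theta>\<in>F. U \<theta>)"
    by metis
  \<comment> \<open>The order will be \<open>s = 1 - t0\<close>; the bound
    \<open>(1 - a) / 2\<close> ensures \<open>a < s\<close> and the bound \<open>1 / 2\<close>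
    ensures \<open>0 < s\<close>.\<close>
  define t0 where "t0 = Min (insert ((1 - a) / 2) (insert (1 / 2) (t ` F)))"
  have t0: "t0 > 0" "t0 \<le> (1 - a) / 2" "t0 \<le> 1 / 2" "\<And>\<theta>. \<theta> \<in> F \<Longrightarrow> t0 \<le> t \<theta>"
  proof -
    let ?S = "insert ((1 - a) / 2) (insert (1 / 2) (t ` F))"
    have S: "finite ?S" "?S \<noteq> {}"
      using F(2) by auto
    show "t0 > 0"
      unfolding t0_def Min_gr_iff[OF S] using F(1) t(1) a by auto
    show "t0 \<le> (1 - a) / 2" "t0 \<le> 1 / 2" "\<And>\<theta>. \<theta> \<in> F \<Longrightarrow> t0 \<le> t \<theta>"
      unfolding t0_def by (intro Min_le[OF S(1)]; simp)+
  qed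
  have "?h \<theta> t0 < 1" if \<theta>: "\<theta> \<in> \<Theta>" for \<theta>
  proof -
    obtain \<theta>' where \<theta>': "\<theta>' \<in> F" "\<theta> \<in> U \<theta>'"
      using F(3) \<theta> by blast
    then have "\<theta> \<in> {\<theta>''\<in>\<Theta>. ?h \<theta>'' (t \<theta>') < 1}"
      using U(2)[of \<theta>', symmetric] F(1) \<theta> by (simp add: subset_iff)
    then have "?h \<theta> (t \<theta>') < 1"
      by simp
    then show ?thesis
      using lr_moment_less_one_mono[OF fin _ t0(1) t0(4)[OF \<theta>'(1)]] by simp
  qed
  then have "ereal c \<le> renyi_div_set B (1 - t0) P (Q ` \<Theta>)"
    unfolding renyi_div_set_def INF_image using t0(1)
    by (intro INF_greatest) (simp add: renyi_div_ge_iff[OF B] less_imp_le)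
  then show thesis
    using t0 a by (intro that[of "1 - t0"]) auto
qed

section \<open>The universal likelihood ratio test and the direct part\<close>

text \<open>Symmetrizing a member of \<open>\<Q>\<close> leaves its error under an invariant test
  unchanged and moves it to where \<open>U\<close> dominates.\<close>

lemma type2_error_symmetric_test_le:
  fixes U :: "'a::finite list pmf"
  assumes \<Q>: "\<Q> \<subseteq> dists n" "\<And>p. p \<in> \<Q> \<Longrightarrow> symmetrize n p \<in> \<Q> \<inter> sym_dists n"
    and U: "\<And>q xs. q \<in> \<Q> \<inter> sym_dists n \<Longrightarrow> xs \<in> words n \<Longrightarrow> pmf q xs \<le> w * pmf U xs"
    and T: "is_test n T"
      "\<And>\<pi> xs. \<pi> permutes {..<n} \<Longrightarrow> xs \<in> words n \<Longrightarrow> T (permute_list \<pi> xs) = T xs"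
  shows "type2_error n T \<Q> \<le> ereal (w * (\<Sum>xs\<in>words n. pmf U xs * T xs))"
  unfolding type2_error_def
proof (rule SUP_least)
  fix q assume q: "q \<in> \<Q>"
  have "(\<Sum>xs\<in>words n. pmf q xs * T xs) = (\<Sum>xs\<in>words n. pmf (symmetrize n q) xs * T xs)"
    using sum_symmetrize[of q n T] q \<Q>(1) T(2) by auto
  also have "\<dots> \<le> (\<Sum>xs\<in>words n. w * pmf U xs * T xs)"
    using U[OF \<Q>(2)[OF q]] T(1) by (intro sum_mono mult_right_mono) (auto simp: is_test_def)
  finally show "ereal (\<Sum>xs\<in>words n. pmf q xs * T xs) \<le> ereal (w * (\<Sum>xs\<in>words n. pmf U xs * T xs))"
    by (simp add: sum_distrib_left mult.assoc)
qed

text \<open>A single threshold test serves both errors: its definition bounds the type 2 error by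
  \<open>\<mu>\<close>, and Markov's inequality bounds the type 1 error.\<close>

lemma min_type1_le_lr_moment:
  fixes P :: "'a::finite pmf" and U :: "'a list pmf"
  assumes \<Q>: "\<Q> \<subseteq> dists n" "\<And>p. p \<in> \<Q> \<Longrightarrow> symmetrize n p \<in> \<Q> \<inter> sym_dists n"
    and U: "U \<in> sym_dists n"
      "\<And>q xs. q \<in> \<Q> \<inter> sym_dists n \<Longrightarrow> xs \<in> words n \<Longrightarrow> pmf q xs \<le> w * pmf U xs"
    and pos: "0 < w" "0 < \<mu>" "0 < k" "0 < t"
    and mom: "lr_moment k (replicate_pmf n P) U t \<le> 1"
  shows "min_type1 n \<mu> (replicate_pmf n P) \<Q> \<le> ereal ((w / (\<mu> * k)) powr t)"
proof -
  let ?p = "replicate_pmf n P"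
  \<comment> \<open>With this choice \<open>?r * k\<close> is \<open>w / \<mu>\<close>, so accepted
    words satisfy \<open>w * pmf U xs < \<mu> * pmf ?p xs\<close>; summing over words gives at most
    \<open>\<mu>\<close>.\<close>
  let ?r = "w / (\<mu> * k)"
  let ?T = "\<lambda>xs. if pmf ?p xs > ?r * k * pmf U xs then 1 else 0 :: real"
  have test: "is_test n ?T"
    by (simp add: is_test_def)
  have "w * (\<Sum>xs\<in>words n. pmf U xs * ?T xs) \<le> \<mu>"
  proof -
    have "w * (\<Sum>xs\<in>words n. pmf U xs * ?T xs) \<le> (\<Sum>xs\<in>words n. \<mu> * pmf ?p xs)"
      unfolding sum_distrib_left using pos by (intro sum_mono) (auto simp: field_simps)
    then show ?thesis
      by (simp add: sum_distrib_left[symmetric] sum_pmf_words[OF replicate_pmf_in_dists])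
  qed
  moreover have "type2_error n ?T \<Q> \<le> ereal (w * (\<Sum>xs\<in>words n. pmf U xs * ?T xs))"
    by (intro type2_error_symmetric_test_le[OF \<Q> U(2) test])
      (simp_all only: pmf_replicate_permute_list pmf_sym_permute_list[OF U(1)])
  ultimately have "type2_error n ?T \<Q> \<le> ereal \<mu>"
    by (meson ereal_less_eq(3) order_trans)
  then have "min_type1 n \<mu> ?p \<Q> \<le> ereal (type1_error n ?T ?p)"
    by (intro min_type1_le test)
  also have "type1_error n ?T ?p \<le> ?r powr t * lr_moment k ?p U t"
    using pos by (intro type1_error_threshold_le replicate_pmf_in_dists) auto
  also have "\<dots> \<le> ?r powr t * 1"
    using mom by (intro mult_left_mono) auto
  finally show ?thesis by simp
qed

text \<open>Given \<open>R < c < D\<close>, the order \<open>s\<close> from \<open>left\<close>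
  yields a moment bound against \<open>U n\<close> with \<open>k = B powr (real n * c)\<close>. The
  type 2 level \<open>B powr (- real n * R)\<close> then leaves an exponential gain of
  \<open>B powr (R - c)\<close> per letter.\<close>

lemma R_th_ge:
  fixes P :: "'a::finite pmf"
  assumes B: "B > 1" and Qs: "\<forall>n\<ge>1. Qs n \<subseteq> dists n"
    and ax3: "axiom3 B J P Qs" and ax4: "axiom4 B J P Qs"
    and left: "\<And>c. ereal c < D \<Longrightarrow> \<exists>s\<in>J. s < 1 \<and> ereal c \<le> renyi_div_set B s P (single_letter Qs)"
  shows "D \<le> R_th B P Qs"
proof (rule ccontr)
  assume "\<not> ?thesis"
  then obtain c where c: "R_th B P Qs < ereal c" "ereal c < D"
    using ereal_dense2 by (meson not_le)
  then obtain R where R: "R_th B P Qs < ereal R" "R < c"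
    using ereal_dense2 by (metis ereal_less_eq(3) not_le)
  obtain s where s: "s \<in> J" "s < 1" "ereal c \<le> renyi_div_set B s P (single_letter Qs)"
    using left[OF c(2)] by blast
  from ax4 obtain U v where sym: "\<And>n p. n \<ge> 1 \<Longrightarrow> p \<in> Qs n \<Longrightarrow> symmetrize n p \<in> Qs n \<inter> sym_dists n"
    and U: "\<And>n. n \<ge> 1 \<Longrightarrow> U n \<in> sym_dists n"
      "\<And>n q xs. n \<ge> 1 \<Longrightarrow> q \<in> Qs n \<inter> sym_dists n \<Longrightarrow> xs \<in> words n \<Longrightarrow> pmf q xs \<le> poly v (real n) * pmf (U n) xs"
      "\<And>n. n \<ge> 1 \<Longrightarrow> renyi_div_set B s (replicate_pmf n P) (Qs n) \<le> renyi_div B s (replicate_pmf n P) (U n)"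
    using s(1) unfolding axiom4_def by metis
  let ?m = "\<lambda>n. min_type1 n (B powr (- real n * R)) (replicate_pmf n P) (Qs n)"
  define q where "q = B powr (R - c)"
  \<comment> \<open>The polynomial need not be positive, but the factor in the threshold must be;
    this majorant still grows only polynomially.\<close>
  define w where "w n = 1 + \<bar>poly v (real n)\<bar>" for n :: nat
  have upper: "?m n \<le> ereal ((w n * q ^ n) powr (1 - s))" if n: "n \<ge> 1" for n
  proof -
    \<comment> \<open>\<open>axiom3\<close> lifts the single-letter bound to \<open>n\<close>
      letters, and \<open>axiom4\<close> passes it from the set to \<open>U n\<close>.\<close>
    have "ereal (real n * c) \<le> ereal (real n) * renyi_div_set B s P (single_letter Qs)"
      using ereal_mult_left_mono[OF s(3), of "ereal (real n)"] by simp
    also have "\<dots> \<le> renyi_div_set B s (replicate_pmf n P) (Qs n)"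
      using ax3 s(1) n by (auto simp: axiom3_def)
    also have "\<dots> \<le> renyi_div B s (replicate_pmf n P) (U n)"
      by (rule U(3)[OF n])
    finally have "lr_moment (B powr (real n * c)) (replicate_pmf n P) (U n) (1 - s) \<le> 1"
      using renyi_div_ge_iff[OF B s(2)] by blast
    moreover have "pmf p xs \<le> w n * pmf (U n) xs" if "p \<in> Qs n \<inter> sym_dists n" "xs \<in> words n" for p xs
    proof -
      have "pmf p xs \<le> poly v (real n) * pmf (U n) xs"
        using U(2) n that by blast
      also have "\<dots> \<le> w n * pmf (U n) xs"
        by (intro mult_right_mono) (auto simp: w_def)
      finally show ?thesis .
    qed
    ultimately have "?m n \<le> ereal ((w n / (B powr (- real n * R) * B powr (real n * c))) powr (1 - s))"
      using B s(2) Qs n sym U(1)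
      by (intro min_type1_le_lr_moment[where U = "U n"]) (auto simp: w_def add_pos_nonneg)
    also have "w n / (B powr (- real n * R) * B powr (real n * c)) = w n * q ^ n"
      using B by (simp add: q_def powr_realpow[symmetric] powr_powr powr_add[symmetric]
          powr_minus_divide[symmetric] divide_powr_uminus algebra_simps)
    finally show ?thesis .
  qed
  have q: "0 < q" "q < 1"
    using B R(2) by (auto simp: q_def powr_less_one)
  have "(\<lambda>n. q ^ n + \<bar>poly v (real n) * q ^ n\<bar>) \<longlonglongrightarrow> 0 + \<bar>0\<bar>"
    using q by (intro tendsto_intros LIMSEQ_power_zero poly_times_power_tendsto_0) auto
  then have "(\<lambda>n. w n * q ^ n) \<longlonglongrightarrow> 0"
    using q by (simp add: w_def abs_mult algebra_simps)
  then have "(\<lambda>n. (w n * q ^ n) powr (1 - s)) \<longlonglongrightarrow> 0 powr (1 - s)"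
    using s(2) q by (intro tendsto_powr' tendsto_const) (auto simp: w_def)
  then have "(\<lambda>n. ereal ((w n * q ^ n) powr (1 - s))) \<longlonglongrightarrow> 0"
    by (simp add: zero_ereal_def)
  then have "?m \<longlonglongrightarrow> 0"
  proof (rule tendsto_sandwich[rotated 3])
    show "\<forall>\<^sub>F n in sequentially. ?m n \<le> ereal ((w n * q ^ n) powr (1 - s))"
      using upper by (intro eventually_sequentiallyI[of 1])
    show "\<forall>\<^sub>F n in sequentially. 0 \<le> ?m n"
      by (intro always_eventually allI min_type1_nonneg)
  qed simp
  then have "limsup ?m = 0"
    by (intro lim_imp_Limsup) auto
  then have "ereal R \<le> R_th B P Qs"
    unfolding R_th_def by (intro SUP_upper) simp
  with R(1) show False by simp
qed

theorem corollary11: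
  fixes B a :: real and b :: ereal and J :: "real set"
    and P :: "'a::finite pmf" and Qs :: "nat \<Rightarrow> 'a list pmf set"
    and \<Theta> :: "'v::euclidean_space set" and Q\<^sub>\<Theta> :: "'v \<Rightarrow> 'a pmf"
  assumes "B > 1"
    and "0 \<le> a" and "a < 1" and "1 < b"
    and "J = {s. a < s \<and> ereal s < b}"
    and "\<forall>n\<ge>1. Qs n \<subseteq> dists n"
    and "axiom2 Qs"
    and "axiom3 B J P Qs"
    and "axiom4 B J P Qs"
    and "axiom5 B J P Qs \<Theta> Q\<^sub>\<Theta>"
  shows "R_th B P Qs = R_th_star B P Qs \<and>
         R_th_star B P Qs = renyi_div_set B 1 P (single_letter Qs)"
proof -
  have \<Theta>: "compact \<Theta>" "\<And>x. continuous_on \<Theta> (\<lambda>\<theta>. pmf (Q\<^sub>\<Theta> \<theta>) x)" "single_letter Qs = Q\<^sub>\<Theta> ` \<Theta>"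
    using assms(10) by (auto simp: axiom5_def intro: C2_on_imp_continuous_on)
  have "renyi_div_set B 1 P (single_letter Qs) \<le> R_th B P Qs"
  proof (rule R_th_ge[OF assms(1,6,8,9)])
    fix c assume "ereal c < renyi_div_set B 1 P (single_letter Qs)"
    then obtain s where s: "a < s" "s < 1" "ereal c \<le> renyi_div_set B s P (single_letter Qs)"
      unfolding \<Theta>(3) by (rule renyi_div_set_left_limit[OF assms(1) \<Theta>(1,2) _ assms(3)])
    moreover have "ereal s < b"
      using s(2) assms(4) by (metis ereal_less(3) less_trans)
    ultimately show "\<exists>s\<in>J. s < 1 \<and> ereal c \<le> renyi_div_set B s P (single_letter Qs)"
      using assms(5) by auto
  qed
  \<comment> \<open>The three inequalities close a cycle, which forces equality throughout.\<close>
  moreover note R_th_le_R_th_star[OF assms(1), of P Qs] R_th_star_le[OF assms(1,7), of P]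
  ultimately show ?thesis
    by (meson antisym order_trans)
qed

end
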